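(* Let $N_A=\{N_A(t)\}_{t\ge0}$ be the variable-order fractional renewal process with parameters $\lambda>0$ and $\alpha(\cdot)$ (defined in the context), and let $Z_A$ denote a generic interarrival time of $N_A$. For every $r\in\mathbb{N}=\{1,2,\dots\}$, the $r$-th factorial moment of $N_A$ has Laplace transform $$\int_0^{+\infty}e^{-st}\,\mathbb{E}\left[N_A(t)(N_A(t)-1)\cdots(N_A(t)-r+1)\right]dt=\frac{r!\,\lambda^r}{s^{rsA(s)+1}},\qquad s>0 .$$ Moreover, the $r$-th moment of the interarrival time is infinite, i.e. $\mathbb{E}[Z_A^r]=+\infty$, for every $r\in\mathbb{N}$.
   Context: Let $\lambda>0$ and let $\alpha:[0,+\infty)\to(0,1)$ be a locally integrable function with Laplace transform $A(s)=\int_0^{+\infty}e^{-st}\alpha(t)\,dt$, $s>0$. Assume that $\lim_{t\to0^+}\alpha(t)=\alpha'$ and $\lim_{t\to+\infty}\alpha(t)=\alpha''$ for some $\alpha',\alpha''\in(0,1)$, and that $s\mapsto s^{sA(s)}$, $s>0$, is a Bernstein function (i.e. it is $C^\infty$, non-negative, and its derivatives satisfy $(-1)^{n-1}g^{(n)}\ge0$ for all $n\ge1$). Under these assumptions there is a non-negative, non-increasing, right-continuous function $u_A$ with $u_A(0^+)=1$ and Laplace transform $\int_0^{+\infty}e^{-st}u_A(t)\,dt=\frac{s^{sA(s)-1}}{\lambda+s^{sA(s)}}$, $s>0$ (it is the solution of the variable-order fractional relaxation equation $D_t^{\alpha(t)}u=-\lambda u$, $u(0)=1$, where $D_t^{\alpha(t)}f(t)=\int_0^t\phi_A(t-\tau)f'(\tau)d\tau$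 and $\phi_A$ has Laplace transform $s^{sA(s)-1}$). The variable-order fractional renewal process $N_A$ is the renewal process whose interarrival times $Z_{A,j}$, $j=1,2,\dots$, are i.i.d. copies of a positive random variable $Z_A$ with $P(Z_A>t)=u_A(t)$, $t\ge0$. Equivalently, $\mathbb{E}e^{-sZ_A}=\frac{\lambda}{\lambda+s^{sA(s)}}$, $s>0$. With $T_k^A=\sum_{j=1}^kZ_{A,j}$, one has $N_A(t)=\sum_{k=1}^\infty 1_{\{T_k^A\le t\}}$. *)

theory Defs
  imports "HOL-Probability.Probability"
begin

definition laplace :: "(real \<Rightarrow> real) \<Rightarrow> real \<Rightarrow> real" where
  "laplace f s = (LINT t:{0..}|lebesgue. exp (- s * t) * f t)"

definition nn_laplace :: "(real \<Rightarrow> ennreal) \<Rightarrow> real \<Rightarrow> ennreal" where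
  "nn_laplace f s = (\<integral>\<^sup>+t\<in>{0..}. ennreal (exp (- s * t)) * f t \<partial>lebesgue)"

definition bernstein_function :: "(real \<Rightarrow> real) \<Rightarrow> bool" where
  "bernstein_function g \<longleftrightarrow>
     (\<forall>n. \<forall>x>0. (deriv ^^ n) g field_differentiable (at x)) \<and>
     (\<forall>x>0. 0 \<le> g x) \<and>
     (\<forall>n\<ge>1. \<forall>x>0. 0 \<le> (- 1) ^ (n - 1) * (deriv ^^ n) g x)"

definition admissible_order :: "(real \<Rightarrow> real) \<Rightarrow> real \<Rightarrow> real \<Rightarrow> bool" where
  "admissible_order \<alpha> \<alpha>\<^sub>0 \<alpha>\<^sub>1 \<longleftrightarrow>
     (\<forall>t\<ge>0. \<alpha> t \<in> {0<..<1}) \<and>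
     (\<forall>T\<ge>0. \<alpha> absolutely_integrable_on {0..T}) \<and>
     \<alpha>\<^sub>0 \<in> {0<..<1} \<and> (\<alpha> \<longlongrightarrow> \<alpha>\<^sub>0) (at_right 0) \<and>
     \<alpha>\<^sub>1 \<in> {0<..<1} \<and> (\<alpha> \<longlongrightarrow> \<alpha>\<^sub>1) at_top \<and>
     bernstein_function (\<lambda>s. s powr (s * laplace \<alpha> s))"

text \<open>The conditions below determine \<open>u\<close> uniquely on \<open>[0,\<infinity>)\<close>; its values at negative
  arguments are irrelevant.\<close>

definition relaxation_function :: "real \<Rightarrow> (real \<Rightarrow> real) \<Rightarrow> (real \<Rightarrow> real) \<Rightarrow> bool" where
  "relaxation_function lam \<alpha> u \<longleftrightarrow>
     (\<forall>t\<ge>0. 0 \<le> u t) \<and>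
     antimono_on {0..} u \<and>
     (\<forall>t\<ge>0. continuous (at_right t) u) \<and>
     (u \<longlongrightarrow> 1) (at_right 0) \<and>
     (\<forall>s>0. laplace u s =
        s powr (s * laplace \<alpha> s - 1) / (lam + s powr (s * laplace \<alpha> s)))"

text \<open>Interarrival times are indexed by \<open>j \<ge> 1\<close>; \<open>Z 0\<close> is unused. They are identically
  distributed because they share the survival function \<open>u\<close>.\<close>

definition iid_interarrival_times ::
  "'a measure \<Rightarrow> (nat \<Rightarrow> 'a \<Rightarrow> real) \<Rightarrow> (real \<Rightarrow> real) \<Rightarrow> bool" where
  "iid_interarrival_times M Z u \<longleftrightarrow>
     prob_space M \<and>
     prob_space.indep_vars M (\<lambda>_. borel) Z {1..} \<and>
     (\<forall>j\<ge>1. AE \<omega> in M. 0 < Z j \<omega>) \<and>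
     (\<forall>j\<ge>1. \<forall>t\<ge>0. measure M {\<omega> \<in> space M. t < Z j \<omega>} = u t)"

definition arrival_time :: "(nat \<Rightarrow> 'a \<Rightarrow> real) \<Rightarrow> nat \<Rightarrow> 'a \<Rightarrow> real" where
  "arrival_time Z k \<omega> = (\<Sum>j=1..k. Z j \<omega>)"

text \<open>The counting process takes values in \<^typ>\<open>ennreal\<close>, so that the series is meaningful even
  on the null set where infinitely many arrivals may occur before time \<open>t\<close>.\<close>

definition counting_process :: "(nat \<Rightarrow> 'a \<Rightarrow> real) \<Rightarrow> real \<Rightarrow> 'a \<Rightarrow> ennreal" where
  "counting_process Z t \<omega> = (\<Sum>k. indicator {\<omega>. arrival_time Z (Suc k) \<omega> \<le> t} \<omega>)"

definition falling_factorial :: "ennreal \<Rightarrow> nat \<Rightarrow> ennreal" where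
  "falling_factorial x r = (\<Prod>i<r. x - of_nat i)"

text \<open>Subtraction on \<^typ>\<open>ennreal\<close> is truncated. At natural numbers this is harmless: if
  \<open>n < r\<close>, then the factor with \<open>i = n\<close> vanishes.\<close>

lemma falling_factorial_of_nat:
  "falling_factorial (of_nat n) r = ennreal (\<Prod>i<r. real n - real i)"
proof (cases "n < r")
  case True
  then have "(\<Prod>i<r. (of_nat n :: ennreal) - of_nat i) = 0"
    by (intro prod_zero) (auto intro!: bexI[of _ n])
  moreover have "(\<Prod>i<r. real n - real i) = 0"
    using True by (intro prod_zero) (auto intro!: bexI[of _ n])
  ultimately show ?thesis unfolding falling_factorial_def by (simp only: ennreal_0)
next
  case False
  then have "(\<Prod>i<r. (of_nat n :: ennreal) - of_nat i) = (\<Prod>i<r. ennreal (real n - real i))"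
    by (intro prod.cong refl) (simp add: ennreal_of_nat_eq_real_of_nat ennreal_minus)
  also have "\<dots> = ennreal (\<Prod>i<r. real n - real i)"
    using False by (intro prod_ennreal) auto
  finally show ?thesis by (simp add: falling_factorial_def)
qed

end

theory Submission
  imports Defs "HOL-Real_Asymp.Real_Asymp"
begin

text \<open>Along an increasing sequence of arrival times the factorial moment of order \<open>r = m + 1\<close> is
  a weighted series of distribution functions,
  \<open>E[N(N-1)\<cdots>(N-m)] = (m+1)! \<Sum>k. (k choose m) P(T\<^sub>k\<^sub>+\<^sub>1 \<le> t)\<close>, whose Laplace transform is summed by
  the negative binomial series at \<open>E[exp(-sZ)] = \<lambda> / (\<lambda> + s\<^bsup>sA(s)\<^esup>)\<close>.
  For the moments of \<open>Z\<close>, the Laplace transform of the survival function at every \<open>s > 0\<close> is a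
  lower bound for \<open>E[Z]\<close>. It tends to infinity as \<open>s \<rightarrow> 0\<close>, because
  \<open>limsup s A(s) \<le> lim \<alpha>(t) < 1\<close>.\<close>

section \<open>Falling factorials and binomial series\<close>

text \<open>Covers sample points with infinitely many arrivals by time \<open>t\<close>. The order
  must be positive, since the empty product is 1.\<close>

lemma falling_factorial_top: "falling_factorial top (Suc m) = top"
  unfolding falling_factorial_def by (induction m) (simp_all add: ennreal_top_mult)

lemma falling_factorial_of_nat_binomial:
  "falling_factorial (of_nat n) r = of_nat (fact r * (n choose r))"
proof -
  have "(\<Prod>i<r. real n - real i) = real (fact r * (n choose r))"
    using gbinomial_mult_fact[of r "real n"]
    by (simp add: binomial_gbinomial lessThan_atLeast0)
  then show ?thesis
    by (simp only: falling_factorial_of_nat) (simp only: ennreal_of_nat_eq_real_of_nat)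
qed

lemma suminf_ennreal_const_top:
  assumes "c \<noteq> 0"
  shows "(\<Sum>k. c :: ennreal) = top"
  using assms by (subst nn_integral_count_space_nat[symmetric]) (simp add: ennreal_mult_top)

text \<open>The indices satisfying \<open>P\<close> form an initial segment. If its length
  \<open>n\<close> is finite, the identity is the hockey-stick formula, which evaluates the sum of
  \<open>k choose m\<close> over \<open>k < n\<close>, multiplied by \<open>fact (Suc m)\<close>. If
  it is all of the naturals, both sides are infinite.\<close>

lemma falling_factorial_count_initial_segment:
  assumes "\<And>k. P (Suc k) \<Longrightarrow> P k"
  shows "falling_factorial (\<Sum>k. of_bool (P k)) (Suc m)
       = (\<Sum>k. of_nat (fact (Suc m) * (k choose m)) * of_bool (P k))"
proof (cases "\<forall>k. P k")
  case True
  \<comment> \<open>From index \<open>m\<close> on, every coefficient is at least 1, so the weighted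
    series diverges together with the count.\<close>
  have "top = (\<Sum>k. 1 :: ennreal)"
    by (simp add: suminf_ennreal_const_top)
  also have "\<dots> \<le> (\<Sum>k. of_nat (fact (Suc m) * ((k + m) choose m)))"
    by (intro suminf_le) (auto simp: ennreal_of_nat_eq_real_of_nat Suc_le_eq simp del: of_nat_mult fact_Suc)
  also have "\<dots> \<le> (\<Sum>k<m. of_nat (fact (Suc m) * (k choose m))) + \<dots>"
    by simp
  also have "\<dots> = (\<Sum>k. of_nat (fact (Suc m) * (k choose m)))"
    by (subst suminf_offset[where i = m]) (simp_all add: add.commute)
  finally show ?thesis
    using True by (simp add: top_unique suminf_ennreal_const_top falling_factorial_top del: of_nat_mult fact_Suc)
next
  case False
  define n where "n = (LEAST k. \<not> P k)"
  have "\<not> P n" using LeastI_ex[of "\<lambda>k. \<not> P k"] False unfolding n_def by blast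
  then have "\<not> P (n + j)" for j
    using assms by (induction j) auto
  then have "\<not> P k" if "n \<le> k" for k using that le_Suc_ex by blast
  moreover have "P k" if "k < n" for k using that not_less_Least unfolding n_def by blast
  ultimately have P: "P k \<longleftrightarrow> k < n" for k by (meson not_less)
  have sum_lt: "(\<Sum>k. f k * of_bool (P k)) = (\<Sum>k<n. f k)" for f :: "nat \<Rightarrow> ennreal"
    by (subst suminf_finite[of "{..<n}"]) (auto simp: P)
  have "(\<Sum>k. of_bool (P k) :: ennreal) = of_nat n"
    using sum_lt[of "\<lambda>_. 1"] by simp
  moreover have "(\<Sum>k<n. k choose m) = n choose Suc m"
  proof (cases n)
    case (Suc j)
    then show ?thesis using sum_choose_upper[of m j] by (simp add: lessThan_Suc_atMost)
  qed simp
  ultimately show ?thesis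
    by (simp only: falling_factorial_of_nat_binomial sum_lt of_nat_sum[symmetric] sum_distrib_left[symmetric])
qed

text \<open>Newton's series for the exponent \<open>- real (Suc m)\<close>, multiplied by
  \<open>x ^ Suc m\<close> and reindexed so that the binomial coefficient reads
  \<open>k choose m\<close>.\<close>

lemma negative_binomial_sums:
  fixes x :: real
  assumes "\<bar>x\<bar> < 1"
  shows "(\<lambda>k. real (k choose m) * x ^ Suc k) sums (x / (1 - x)) ^ Suc m"
proof -
  \<comment> \<open>Upper negation: the sign of the generalized binomial coefficient cancels the
    sign of \<open>(- x) ^ n\<close>.\<close>
  have "(- real (Suc m) gchoose n) * (- x) ^ n = real ((n + m) choose m) * x ^ n" for n
  proof -
    have "(- real (Suc m) gchoose n) * (- x) ^ n
        = (- 1) ^ n * real ((n + m) choose n) * ((- 1) ^ n * x ^ n)"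
      by (subst gbinomial_minus, subst (2) power_minus) (simp add: binomial_gbinomial algebra_simps)
    also have "\<dots> = ((- 1) * (- 1)) ^ n * (real ((n + m) choose n) * x ^ n)"
      by (simp only: power_mult_distrib mult_ac)
    also have "(n + m) choose n = (n + m) choose m"
      using binomial_symmetric[of n "n + m"] by simp
    finally show ?thesis by simp
  qed
  then have "(\<lambda>n. real ((n + m) choose m) * x ^ n) sums (1 - x) powr (- real (Suc m))"
    using gen_binomial_real[of "- x" "- real (Suc m)"] assms by simp
  also have "(1 - x) powr (- real (Suc m)) = inverse ((1 - x) ^ Suc m)"
    using assms by (simp only: powr_minus) (subst powr_realpow, auto)
  finally have "(\<lambda>n. x ^ Suc m * (real ((n + m) choose m) * x ^ n)) sums
      (x ^ Suc m * inverse ((1 - x) ^ Suc m))"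
    by (rule sums_mult)
  then have "(\<lambda>n. real ((n + m) choose m) * x ^ Suc (n + m)) sums (x / (1 - x)) ^ Suc m"
    by (simp add: power_add power_mult_distrib power_inverse divide_inverse mult_ac)
  \<comment> \<open>The coefficients below \<open>m\<close> vanish, so shifting the index by
    \<open>m\<close> leaves the sum unchanged.\<close>
  moreover have "(\<Sum>k<m. real (k choose m) * x ^ Suc k) = 0"
    by (intro sum.neutral) (auto simp: binomial_eq_0)
  ultimately show ?thesis
    by (subst (asm) sums_iff_shift) simp
qed

section \<open>Laplace transforms of distribution and survival functions\<close>

text \<open>Completing a measure does not change nonnegative integrals. Over \<open>lborel\<close>,
  Borel measurability and Fubini with \<open>M\<close> are directly available.\<close>

lemma nn_laplace_lborel:
  "nn_laplace f s = (\<integral>\<^sup>+t\<in>{0..}. ennreal (exp (- s * t)) * f t \<partial>lborel)"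
  unfolding nn_laplace_def by (simp add: nn_integral_completion)

lemma nn_integral_exp_atLeast:
  fixes s a :: real
  assumes "0 < s"
  shows "(\<integral>\<^sup>+t\<in>{a..}. ennreal (exp (- s * t)) \<partial>lborel) = ennreal (exp (- s * a) / s)"
proof -
  have "(\<integral>\<^sup>+t. ennreal (exp (- s * t)) * indicator {a..} t \<partial>lborel)
      = ennreal (0 - (- exp (- s * a) / s))"
  proof (rule nn_integral_FTC_atLeast)
    show "((\<lambda>t. - exp (- s * t) / s) \<longlongrightarrow> 0) at_top"
      using assms by real_asymp
  qed (use assms in \<open>auto intro!: derivative_eq_intros simp: field_simps\<close>)
  then show ?thesis by simp
qed

lemma nn_integral_of_bool:
  assumes "Measurable.pred M P"
  shows "(\<integral>\<^sup>+\<omega>. of_bool (P \<omega>) \<partial>M) = emeasure M {\<omega> \<in> space M. P \<omega>}"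
proof -
  have "(\<integral>\<^sup>+\<omega>. of_bool (P \<omega>) \<partial>M) = (\<integral>\<^sup>+\<omega>. indicator {\<omega> \<in> space M. P \<omega>} \<omega> \<partial>M)"
    by (intro nn_integral_cong) (auto simp: indicator_def)
  then show ?thesis using assms by simp
qed

context prob_space
begin

text \<open>Tonelli for \<open>lborel\<close> and \<open>M\<close>, with the probability written as
  the integral of an indicator. The relation \<open>Q\<close> is kept general to serve both
  distribution and survival functions.\<close>

lemma nn_integral_distribution:
  fixes w :: "real \<Rightarrow> ennreal"
  assumes [measurable]: "X \<in> borel_measurable M" "w \<in> borel_measurable borel"
    and Q[measurable]: "Measurable.pred (borel \<Otimes>\<^sub>M borel) (\<lambda>(t, x). Q t x)"
  shows "(\<integral>\<^sup>+t\<in>{0..}. w t * emeasure M {\<omega> \<in> space M. Q t (X \<omega>)} \<partial>lborel)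
       = (\<integral>\<^sup>+\<omega>. (\<integral>\<^sup>+t\<in>{0..}. w t * of_bool (Q t (X \<omega>)) \<partial>lborel) \<partial>M)"
proof -
  interpret pair_sigma_finite lborel M ..
  have "(\<integral>\<^sup>+t\<in>{0..}. w t * emeasure M {\<omega> \<in> space M. Q t (X \<omega>)} \<partial>lborel)
      = (\<integral>\<^sup>+t. (\<integral>\<^sup>+\<omega>. w t * of_bool (Q t (X \<omega>)) * indicator {0..} t \<partial>M) \<partial>lborel)"
  proof (intro nn_integral_cong)
    fix t
    have "emeasure M {\<omega> \<in> space M. Q t (X \<omega>)} = (\<integral>\<^sup>+\<omega>. of_bool (Q t (X \<omega>)) \<partial>M)"
      by (rule nn_integral_of_bool[symmetric]) measurable
    then show "w t * emeasure M {\<omega> \<in> space M. Q t (X \<omega>)} * indicator {0..} t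
        = (\<integral>\<^sup>+\<omega>. w t * of_bool (Q t (X \<omega>)) * indicator {0..} t \<partial>M)"
      by (simp add: nn_integral_cmult nn_integral_multc)
  qed
  also have "\<dots> = (\<integral>\<^sup>+\<omega>. (\<integral>\<^sup>+t. w t * of_bool (Q t (X \<omega>)) * indicator {0..} t \<partial>lborel) \<partial>M)"
    by (rule Fubini'[symmetric]) measurable
  finally show ?thesis .
qed

text \<open>After Tonelli, the inner integral for fixed \<open>\<omega>\<close> is that of the
  exponential over the half-line from \<open>X \<omega>\<close>; this half-line lies in
  \<open>{0..}\<close> because \<open>X \<omega>\<close> is nonnegative almost surely.\<close>

lemma nn_laplace_cdf:
  assumes [measurable]: "X \<in> borel_measurable M" and "AE \<omega> in M. 0 \<le> X \<omega>" and s: "0 < s"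
  shows "nn_laplace (\<lambda>t. emeasure M {\<omega> \<in> space M. X \<omega> \<le> t}) s
       = (\<integral>\<^sup>+\<omega>. ennreal (exp (- s * X \<omega>)) \<partial>M) * ennreal (1 / s)"
proof -
  have "nn_laplace (\<lambda>t. emeasure M {\<omega> \<in> space M. X \<omega> \<le> t}) s
      = (\<integral>\<^sup>+\<omega>. (\<integral>\<^sup>+t\<in>{0..}. ennreal (exp (- s * t)) * of_bool (X \<omega> \<le> t) \<partial>lborel) \<partial>M)"
    unfolding nn_laplace_lborel by (rule nn_integral_distribution) measurable
  also have "\<dots> = (\<integral>\<^sup>+\<omega>. ennreal (exp (- s * X \<omega>)) * ennreal (1 / s) \<partial>M)"
  proof (rule nn_integral_cong_AE, use assms(2) in eventually_elim)
    fix \<omega> assume "0 \<le> X \<omega>"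
    then have "(\<integral>\<^sup>+t\<in>{0..}. ennreal (exp (- s * t)) * of_bool (X \<omega> \<le> t) \<partial>lborel)
        = (\<integral>\<^sup>+t\<in>{X \<omega>..}. ennreal (exp (- s * t)) \<partial>lborel)"
      by (intro nn_integral_cong) (auto simp: indicator_def)
    also have "\<dots> = ennreal (exp (- s * X \<omega>)) * ennreal (1 / s)"
      using s by (simp only: nn_integral_exp_atLeast) (simp flip: ennreal_mult')
    finally show "(\<integral>\<^sup>+t\<in>{0..}. ennreal (exp (- s * t)) * of_bool (X \<omega> \<le> t) \<partial>lborel)
        = ennreal (exp (- s * X \<omega>)) * ennreal (1 / s)" .
  qed
  finally show ?thesis by (simp add: nn_integral_multc)
qed

text \<open>The two probabilities add up to 1 at each \<open>t\<close>. The additive form avoids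
  truncated subtraction on \<open>ennreal\<close>.\<close>

lemma nn_laplace_survival_add_cdf:
  assumes [measurable]: "X \<in> borel_measurable M" and s: "0 < s"
  shows "nn_laplace (\<lambda>t. emeasure M {\<omega> \<in> space M. t < X \<omega>}) s
       + nn_laplace (\<lambda>t. emeasure M {\<omega> \<in> space M. X \<omega> \<le> t}) s = ennreal (1 / s)"
proof -
  have compl: "emeasure M {\<omega> \<in> space M. t < X \<omega>} + emeasure M {\<omega> \<in> space M. X \<omega> \<le> t} = 1" for t
  proof -
    have "{\<omega> \<in> space M. t < X \<omega>} \<union> {\<omega> \<in> space M. X \<omega> \<le> t} = space M" by auto
    then show ?thesis
      by (subst plus_emeasure) (auto simp: emeasure_space_1)
  qed
  have "nn_laplace (\<lambda>t. emeasure M {\<omega> \<in> space M. t < X \<omega>}) s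
      + nn_laplace (\<lambda>t. emeasure M {\<omega> \<in> space M. X \<omega> \<le> t}) s
      = (\<integral>\<^sup>+t. ennreal (exp (- s * t)) * emeasure M {\<omega> \<in> space M. t < X \<omega>} * indicator {0..} t
          + ennreal (exp (- s * t)) * emeasure M {\<omega> \<in> space M. X \<omega> \<le> t} * indicator {0..} t \<partial>lborel)"
    unfolding nn_laplace_lborel by (rule nn_integral_add[symmetric]) measurable
  also have "\<dots> = (\<integral>\<^sup>+t\<in>{0..}. ennreal (exp (- s * t)) \<partial>lborel)"
    by (intro nn_integral_cong)
      (simp only: distrib_left[symmetric] distrib_right[symmetric] compl mult_1_right)
  also have "\<dots> = ennreal (1 / s)" using nn_integral_exp_atLeast[OF s, of 0] by simp
  finally show ?thesis .
qed

text \<open>The weight is at most 1 on \<open>{0..}\<close>. Dropping it leaves the integrated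
  survival function, which is the expectation of the positive part
  \<open>ennreal (X \<omega>)\<close> by the layer-cake formula.\<close>

lemma nn_laplace_survival_le_expectation:
  assumes [measurable]: "X \<in> borel_measurable M" and s: "0 < s"
  shows "nn_laplace (\<lambda>t. emeasure M {\<omega> \<in> space M. t < X \<omega>}) s \<le> (\<integral>\<^sup>+\<omega>. ennreal (X \<omega>) \<partial>M)"
proof -
  have "nn_laplace (\<lambda>t. emeasure M {\<omega> \<in> space M. t < X \<omega>}) s
      \<le> (\<integral>\<^sup>+t\<in>{0..}. 1 * emeasure M {\<omega> \<in> space M. t < X \<omega>} \<partial>lborel)"
    unfolding nn_laplace_lborel
  proof (intro nn_integral_mono)
    fix t
    let ?F = "emeasure M {\<omega> \<in> space M. t < X \<omega>}"
    show "ennreal (exp (- s * t)) * ?F * indicator {0..} t \<le> 1 * ?F * indicator {0..} t"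
    proof (cases "0 \<le> t")
      case True
      then have "ennreal (exp (- s * t)) \<le> 1" using s by simp
      then show ?thesis by (intro mult_right_mono) auto
    qed simp
  qed
  also have "\<dots> = (\<integral>\<^sup>+\<omega>. (\<integral>\<^sup>+t\<in>{0..}. 1 * of_bool (t < X \<omega>) \<partial>lborel) \<partial>M)"
    by (rule nn_integral_distribution) measurable
  also have "\<dots> = (\<integral>\<^sup>+\<omega>. ennreal (X \<omega>) \<partial>M)"
  proof (rule nn_integral_cong)
    fix \<omega>
    have "(\<integral>\<^sup>+t\<in>{0..}. 1 * of_bool (t < X \<omega>) \<partial>lborel) = (\<integral>\<^sup>+t. indicator {0..<X \<omega>} t \<partial>lborel)"
      by (intro nn_integral_cong) (auto simp: indicator_def)
    also have "\<dots> = ennreal (X \<omega>)"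
      by (cases "0 \<le> X \<omega>") (simp_all add: ennreal_neg)
    finally show "(\<integral>\<^sup>+t\<in>{0..}. 1 * of_bool (t < X \<omega>) \<partial>lborel) = ennreal (X \<omega>)" .
  qed
  finally show ?thesis .
qed

text \<open>Links the Bochner integral in \<open>laplace\<close> with the nonnegative integral in
  \<open>nn_laplace\<close>. Domination by the exponential gives integrability, which rules out the
  default value 0 of the Bochner integral.\<close>

lemma nn_laplace_survival:
  assumes [measurable]: "X \<in> borel_measurable M" and s: "0 < s"
    and u: "\<And>t. 0 \<le> t \<Longrightarrow> prob {\<omega> \<in> space M. t < X \<omega>} = u t"
  shows "nn_laplace (\<lambda>t. emeasure M {\<omega> \<in> space M. t < X \<omega>}) s = ennreal (laplace u s)"
proof -
  \<comment> \<open>The survival function stands in for \<open>u\<close>, whose values at negative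
    arguments are unknown, so that \<open>f\<close> is Borel on the whole line.\<close>
  define f where "f t = indicator {0..} t * (exp (- s * t) * prob {\<omega> \<in> space M. t < X \<omega>})" for t
  have [measurable]: "f \<in> borel_measurable borel"
    unfolding f_def measure_def by measurable
  have f_nonneg: "0 \<le> f t" for t unfolding f_def by simp
  have f_le: "f t \<le> exp (- s * t) * indicator {0..} t" for t
    unfolding f_def by (auto simp: indicator_def mult_left_le)
  have "(\<integral>\<^sup>+t. ennreal (f t) \<partial>lborel) \<le> (\<integral>\<^sup>+t\<in>{0..}. ennreal (exp (- s * t)) \<partial>lborel)"
  proof (intro nn_integral_mono)
    fix t
    show "ennreal (f t) \<le> ennreal (exp (- s * t)) * indicator {0..} t"
      using f_le[of t] by (cases "0 \<le> t") (auto simp: f_def)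
  qed
  also have "\<dots> < top" using nn_integral_exp_atLeast[OF s, of 0] by simp
  finally have "integrable lborel f"
    by (intro integrableI_nonneg) (auto simp: f_nonneg)
  then have "(\<integral>\<^sup>+t. ennreal (f t) \<partial>lborel) = ennreal (integral\<^sup>L lborel f)"
    by (intro nn_integral_eq_integral) (auto simp: f_nonneg)
  moreover have "nn_laplace (\<lambda>t. emeasure M {\<omega> \<in> space M. t < X \<omega>}) s = (\<integral>\<^sup>+t. ennreal (f t) \<partial>lborel)"
    unfolding nn_laplace_lborel f_def
    by (intro nn_integral_cong) (auto simp: indicator_def emeasure_eq_measure ennreal_mult)
  moreover have "laplace u s = integral\<^sup>L lebesgue f"
    unfolding laplace_def set_lebesgue_integral_def f_def
    by (intro Bochner_Integration.integral_cong) (auto simp: indicator_def u)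
  moreover have "integral\<^sup>L lebesgue f = integral\<^sup>L lborel f"
    by (intro integral_completion) simp
  ultimately show ?thesis by simp
qed

text \<open>Solves the linear relation between the transforms of survival function, distribution
  function and law for the last one.\<close>

lemma nn_integral_exp_of_survival:
  assumes [measurable]: "X \<in> borel_measurable M" and "AE \<omega> in M. 0 \<le> X \<omega>" and s: "0 < s"
    and v: "nn_laplace (\<lambda>t. emeasure M {\<omega> \<in> space M. t < X \<omega>}) s = ennreal v" "0 \<le> v"
  shows "(\<integral>\<^sup>+\<omega>. ennreal (exp (- s * X \<omega>)) \<partial>M) = ennreal (1 - s * v)"
proof -
  let ?E = "\<integral>\<^sup>+\<omega>. ennreal (exp (- s * X \<omega>)) \<partial>M"
  have "ennreal v + ?E * ennreal (1 / s) = ennreal (1 / s)"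
    using nn_laplace_survival_add_cdf[OF assms(1) s] nn_laplace_cdf[OF assms(1-3)] v by simp
  \<comment> \<open>Finiteness of the expectation permits solving the equation in the reals.\<close>
  moreover have "?E \<le> (\<integral>\<^sup>+\<omega>. 1 \<partial>M)"
    by (rule nn_integral_mono_AE, use assms(2) in eventually_elim) (use s in simp)
  then have "?E < top" by (simp add: emeasure_space_1 le_less_trans)
  then obtain e where e: "?E = ennreal e" "0 \<le> e" by (cases ?E) auto
  ultimately have "ennreal (v + e * (1 / s)) = ennreal (1 / s)"
    using v s e ennreal_mult''[of "1 / s" e] by (simp add: ennreal_plus)
  then have "v + e * (1 / s) = 1 / s" using v e s by (subst (asm) ennreal_inj) auto
  then show ?thesis using e s by (simp add: field_simps)
qed

text \<open>For \<open>x \<ge> 0\<close> and \<open>r \<ge> 1\<close> one has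
  \<open>x \<le> 1 + x ^ r\<close>, and the constant 1 contributes only a finite amount on a
  probability space.\<close>

lemma nn_moment_eq_top:
  assumes [measurable]: "X \<in> borel_measurable M"
    and "AE \<omega> in M. 0 \<le> X \<omega>" "(\<integral>\<^sup>+\<omega>. ennreal (X \<omega>) \<partial>M) = \<infinity>" "1 \<le> r"
  shows "(\<integral>\<^sup>+\<omega>. ennreal (X \<omega> ^ r) \<partial>M) = \<infinity>"
proof -
  have "(\<integral>\<^sup>+\<omega>. ennreal (X \<omega>) \<partial>M) \<le> (\<integral>\<^sup>+\<omega>. 1 + ennreal (X \<omega> ^ r) \<partial>M)"
  proof (rule nn_integral_mono_AE, use assms(2) in eventually_elim)
    fix \<omega> assume X: "0 \<le> X \<omega>"
    have "X \<omega> \<le> 1 + X \<omega> ^ r"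
    proof (cases "X \<omega> \<le> 1")
      case False
      then have "X \<omega> \<le> X \<omega> ^ r" using assms(4) by (intro self_le_power) auto
      then show ?thesis by simp
    qed (use X in \<open>simp add: add_increasing2\<close>)
    then have "ennreal (X \<omega>) \<le> ennreal (1 + X \<omega> ^ r)" by (rule ennreal_leI)
    then show "ennreal (X \<omega>) \<le> 1 + ennreal (X \<omega> ^ r)"
      using X by (simp add: ennreal_plus)
  qed
  also have "\<dots> = 1 + (\<integral>\<^sup>+\<omega>. ennreal (X \<omega> ^ r) \<partial>M)"
    by (subst nn_integral_add) (auto simp: emeasure_space_1)
  finally show ?thesis using assms(3) by (auto simp: top_unique)
qed

section \<open>Factorial moments of a counting process\<close>

text \<open>Almost surely all interarrival times are positive, so once an arrival falls after
  \<open>t\<close>, all later ones do. The counting identity then applies pointwise, and monotone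
  convergence moves the expectation inside the series.\<close>

lemma nn_factorial_moment:
  assumes Z[measurable]: "\<And>j. 1 \<le> j \<Longrightarrow> Z j \<in> borel_measurable M"
    and pos: "\<And>j. 1 \<le> j \<Longrightarrow> AE \<omega> in M. 0 < Z j \<omega>"
  shows "(\<integral>\<^sup>+\<omega>. falling_factorial (counting_process Z t \<omega>) (Suc m) \<partial>M)
       = (\<Sum>k. of_nat (fact (Suc m) * (k choose m)) *
            emeasure M {\<omega> \<in> space M. arrival_time Z (Suc k) \<omega> \<le> t})"
proof -
  let ?c = "\<lambda>k. of_nat (fact (Suc m) * (k choose m)) :: ennreal"
  have [measurable]: "arrival_time Z k \<in> borel_measurable M" for k
    unfolding arrival_time_def by measurable
  have "AE \<omega> in M. \<forall>j\<in>{1..}. 0 < Z j \<omega>"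
    using pos by (subst AE_ball_countable) auto
  then have "(\<integral>\<^sup>+\<omega>. falling_factorial (counting_process Z t \<omega>) (Suc m) \<partial>M)
      = (\<integral>\<^sup>+\<omega>. (\<Sum>k. ?c k * of_bool (arrival_time Z (Suc k) \<omega> \<le> t)) \<partial>M)"
  proof (intro nn_integral_cong_AE, elim eventually_mono)
    fix \<omega> assume pos: "\<forall>j\<in>{1..}. 0 < Z j \<omega>"
    have "arrival_time Z (Suc k) \<omega> \<le> t" if "arrival_time Z (Suc (Suc k)) \<omega> \<le> t" for k
      using that pos[rule_format, of "Suc (Suc k)"] by (simp add: arrival_time_def)
    then have "falling_factorial (\<Sum>k. of_bool (arrival_time Z (Suc k) \<omega> \<le> t)) (Suc m)
        = (\<Sum>k. ?c k * of_bool (arrival_time Z (Suc k) \<omega> \<le> t))"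
      by (rule falling_factorial_count_initial_segment)
    then show "falling_factorial (counting_process Z t \<omega>) (Suc m)
        = (\<Sum>k. ?c k * of_bool (arrival_time Z (Suc k) \<omega> \<le> t))"
      by (simp add: counting_process_def indicator_def of_bool_def)
  qed
  also have "\<dots> = (\<Sum>k. \<integral>\<^sup>+\<omega>. ?c k * of_bool (arrival_time Z (Suc k) \<omega> \<le> t) \<partial>M)"
    by (intro nn_integral_suminf) measurable
  also have "\<dots> = (\<Sum>k. ?c k * emeasure M {\<omega> \<in> space M. arrival_time Z (Suc k) \<omega> \<le> t})"
  proof (intro suminf_cong)
    fix k
    have "(\<integral>\<^sup>+\<omega>. of_bool (arrival_time Z (Suc k) \<omega> \<le> t) \<partial>M)
        = emeasure M {\<omega> \<in> space M. arrival_time Z (Suc k) \<omega> \<le> t}"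
      by (rule nn_integral_of_bool) measurable
    then show "(\<integral>\<^sup>+\<omega>. ?c k * of_bool (arrival_time Z (Suc k) \<omega> \<le> t) \<partial>M)
        = ?c k * emeasure M {\<omega> \<in> space M. arrival_time Z (Suc k) \<omega> \<le> t}"
      by (simp add: nn_integral_cmult)
  qed
  finally show ?thesis .
qed

text \<open>The exponential turns the sum of interarrival times into a product, which factorizes
  under the expectation by independence.\<close>

lemma nn_integral_exp_arrival_time:
  assumes indep: "indep_vars (\<lambda>_. borel) Z {1..}"
    and e: "\<And>j. 1 \<le> j \<Longrightarrow> (\<integral>\<^sup>+\<omega>. ennreal (exp (- s * Z j \<omega>)) \<partial>M) = e"
  shows "(\<integral>\<^sup>+\<omega>. ennreal (exp (- s * arrival_time Z k \<omega>)) \<partial>M) = e ^ k"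
proof -
  have "indep_vars (\<lambda>_. borel) (\<lambda>j \<omega>. ennreal (exp (- s * Z j \<omega>))) {1..}"
    by (rule indep_vars_compose2[OF indep]) measurable
  then have *: "indep_vars (\<lambda>_. borel) (\<lambda>j \<omega>. ennreal (exp (- s * Z j \<omega>))) {1..k}"
    by (rule indep_vars_subset) auto
  have "(\<integral>\<^sup>+\<omega>. ennreal (exp (- s * arrival_time Z k \<omega>)) \<partial>M)
      = (\<integral>\<^sup>+\<omega>. (\<Prod>j=1..k. ennreal (exp (- s * Z j \<omega>))) \<partial>M)"
    by (simp add: arrival_time_def prod_ennreal exp_sum sum_distrib_left flip: sum_negf)
  also have "\<dots> = (\<Prod>j=1..k. \<integral>\<^sup>+\<omega>. ennreal (exp (- s * Z j \<omega>)) \<partial>M)"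
    by (rule indep_vars_nn_integral[OF _ *]) auto
  also have "\<dots> = (\<Prod>j=1..k. e)" by (intro prod.cong refl e) auto
  also have "\<dots> = e ^ k" by simp
  finally show ?thesis .
qed

text \<open>Each distribution function of \<open>arrival_time Z (Suc k)\<close> has transform
  \<open>\<phi> ^ Suc k / s\<close>, so the weighted series becomes the negative binomial series at
  \<open>\<phi>\<close>.\<close>

lemma nn_laplace_factorial_moment:
  assumes indep: "indep_vars (\<lambda>_. borel) Z {1..}"
    and pos: "\<And>j. 1 \<le> j \<Longrightarrow> AE \<omega> in M. 0 < Z j \<omega>"
    and \<phi>: "\<And>j. 1 \<le> j \<Longrightarrow> (\<integral>\<^sup>+\<omega>. ennreal (exp (- s * Z j \<omega>)) \<partial>M) = ennreal \<phi>"
    and s: "0 < s" and "0 \<le> \<phi>" "\<phi> < 1"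
  shows "nn_laplace (\<lambda>t. \<integral>\<^sup>+\<omega>. falling_factorial (counting_process Z t \<omega>) (Suc m) \<partial>M) s
       = ennreal (fact (Suc m) * (\<phi> / (1 - \<phi>)) ^ Suc m / s)"
proof -
  let ?c = "\<lambda>k. of_nat (fact (Suc m) * (k choose m)) :: ennreal"
  have Z[measurable]: "1 \<le> j \<Longrightarrow> Z j \<in> borel_measurable M" for j
    using indep unfolding indep_vars_def by auto
  have [measurable]: "arrival_time Z k \<in> borel_measurable M" for k
    unfolding arrival_time_def by measurable
  have all_pos: "AE \<omega> in M. \<forall>j\<in>{1..}. 0 < Z j \<omega>"
    using pos by (subst AE_ball_countable) auto
  have nonneg: "AE \<omega> in M. 0 \<le> arrival_time Z k \<omega>" for k
    using all_pos by eventually_elim (auto simp: arrival_time_def intro!: sum_nonneg intro: less_imp_le)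
  have laplace_cdf: "nn_laplace (\<lambda>t. emeasure M {\<omega> \<in> space M. arrival_time Z k \<omega> \<le> t}) s
      = ennreal \<phi> ^ k * ennreal (1 / s)" for k
  proof -
    have "(\<integral>\<^sup>+\<omega>. ennreal (exp (- s * arrival_time Z k \<omega>)) \<partial>M) = ennreal \<phi> ^ k"
      using indep \<phi> by (rule nn_integral_exp_arrival_time)
    then show ?thesis by (subst nn_laplace_cdf[OF _ nonneg s]) auto
  qed
  have moment: "(\<integral>\<^sup>+\<omega>. falling_factorial (counting_process Z t \<omega>) (Suc m) \<partial>M)
      = (\<Sum>k. ?c k * emeasure M {\<omega> \<in> space M. arrival_time Z (Suc k) \<omega> \<le> t})" for t
    using Z pos by (rule nn_factorial_moment)
  have "nn_laplace (\<lambda>t. \<integral>\<^sup>+\<omega>. falling_factorial (counting_process Z t \<omega>) (Suc m) \<partial>M) s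
      = (\<integral>\<^sup>+t. (\<Sum>k. ?c k * (ennreal (exp (- s * t)) *
          emeasure M {\<omega> \<in> space M. arrival_time Z (Suc k) \<omega> \<le> t} * indicator {0..} t)) \<partial>lborel)"
    unfolding nn_laplace_lborel moment
    by (intro nn_integral_cong)
      (simp only: ennreal_suminf_cmult[symmetric] ennreal_suminf_multc[symmetric] mult_ac)
  also have "\<dots> = (\<Sum>k. ?c k * nn_laplace (\<lambda>t. emeasure M {\<omega> \<in> space M. arrival_time Z (Suc k) \<omega> \<le> t}) s)"
    unfolding nn_laplace_lborel
    by (subst nn_integral_suminf) (simp_all add: nn_integral_cmult del: of_nat_mult)
  also have "\<dots> = (\<Sum>k. ?c k * (ennreal \<phi> ^ Suc k * ennreal (1 / s)))"
    by (simp only: laplace_cdf)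
  also have "\<dots> = (\<Sum>k. ennreal (fact (Suc m) / s * (real (k choose m) * \<phi> ^ Suc k)))"
    using assms
    by (intro suminf_cong)
      (simp add: ennreal_of_nat_eq_real_of_nat ennreal_power field_simps of_nat_mult[where 'a = real]
        flip: ennreal_mult del: of_nat_mult fact_Suc power_Suc)
  also have "\<dots> = ennreal (fact (Suc m) / s * (\<phi> / (1 - \<phi>)) ^ Suc m)"
    using assms by (intro suminf_ennreal_eq sums_mult negative_binomial_sums) auto
  finally show ?thesis by (simp add: mult.commute)
qed

end

section \<open>Behaviour at zero of the Laplace transform of the order\<close>

lemma laplace_nonneg:
  assumes "\<And>t. 0 \<le> t \<Longrightarrow> 0 \<le> f t"
  shows "0 \<le> laplace f s"
  unfolding laplace_def set_lebesgue_integral_def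
  using assms by (intro Bochner_Integration.integral_nonneg) (auto simp: indicator_def)

text \<open>No integrability is needed: a Bochner integral that does not exist is \<open>0\<close>.\<close>

lemma laplace_le_of_eventually_le:
  assumes "0 < s" "0 \<le> T" "0 \<le> c"
    and "\<And>t. 0 \<le> t \<Longrightarrow> f t \<le> 1" "\<And>t. T \<le> t \<Longrightarrow> f t \<le> c"
  shows "s * laplace f s \<le> s * T + c"
proof -
  \<comment> \<open>Majorant of the integrand: 1 on \<open>{0..T}\<close>, plus the exponential with
    factor \<open>c\<close> on the whole half-line. Its integral is
    \<open>T + c / s\<close>.\<close>
  define g where "g t = indicator {0..T} t + c * (indicator {0..} t * exp (- s * t))" for t
  have exp_nn: "(\<integral>\<^sup>+t. ennreal (indicator {0..} t * exp (- s * t)) \<partial>lborel) = ennreal (1 / s)"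
    using nn_integral_exp_atLeast[OF assms(1), of 0]
    by (simp add: mult.commute ennreal_indicator ennreal_mult'' flip: ennreal_indicator)
  have exp_hbi: "has_bochner_integral lborel (\<lambda>t. indicator {0..} t * exp (- s * t)) (1 / s)"
    by (rule has_bochner_integral_nn_integral[OF _ _ _ exp_nn]) (use assms in auto)
  have "has_bochner_integral lborel g (T + c * (1 / s))"
    unfolding g_def
    by (intro has_bochner_integral_add has_bochner_integral_mult_right exp_hbi)
      (use assms has_bochner_integral_real_indicator[of "{0..T}" lborel] in auto)
  then have g: "has_bochner_integral lebesgue g (T + c * (1 / s))"
    by (auto simp: has_bochner_integral_iff integrable_completion integral_completion
        dest: borel_measurable_integrable)
  have "laplace f s \<le> T + c * (1 / s)"
  proof (cases "integrable lebesgue (\<lambda>t. indicator {0..} t *\<^sub>R (exp (- s * t) * f t))")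
    case True
    have "indicator {0..} t *\<^sub>R (exp (- s * t) * f t) \<le> g t" for t
    proof -
      consider "t < 0" | "0 \<le> t" "t \<le> T" | "T < t" by linarith
      then show ?thesis
      proof cases
        case 2
        have "exp (- s * t) * f t \<le> exp (- s * t) * 1"
          using assms 2 by (intro mult_left_mono) auto
        also have "\<dots> \<le> 1" using assms 2 by simp
        finally show ?thesis
          using 2 assms by (simp add: g_def add_increasing2)
      next
        case 3
        have "exp (- s * t) * f t \<le> exp (- s * t) * c"
          using assms 3 by (intro mult_left_mono) auto
        then show ?thesis using 3 assms by (simp add: g_def mult.commute)
      qed (simp add: g_def)
    qed
    then have "laplace f s \<le> integral\<^sup>L lebesgue g"
      unfolding laplace_def set_lebesgue_integral_def
      using True g by (intro integral_mono) (auto simp: has_bochner_integral_iff)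
    then show ?thesis using g by (simp add: has_bochner_integral_iff)
  next
    case False
    then have "laplace f s = 0"
      unfolding laplace_def set_lebesgue_integral_def by (rule not_integrable_integral_eq)
    then show ?thesis using assms by simp
  qed
  then have "s * laplace f s \<le> s * (T + c * (1 / s))" using assms by (intro mult_left_mono) auto
  then show ?thesis using assms by (simp add: distrib_left)
qed

text \<open>With \<open>p = s * laplace \<alpha> s\<close>, small \<open>s\<close> gives
  \<open>0 \<le> p \<le> d\<close> for a fixed \<open>d < 1\<close>. The quotient is then at least
  \<open>s powr (d - 1) / (lam + 1)\<close>, which blows up at 0.\<close>

lemma relaxation_laplace_unbounded:
  assumes lam: "0 < lam" and adm: "admissible_order \<alpha> \<alpha>\<^sub>0 \<alpha>\<^sub>1"
  shows "\<exists>s>0. B \<le> s powr (s * laplace \<alpha> s - 1) / (lam + s powr (s * laplace \<alpha> s))"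
proof -
  have \<alpha>: "0 < \<alpha> t" "\<alpha> t < 1" if "0 \<le> t" for t
    using adm that unfolding admissible_order_def by auto
  have \<alpha>1: "0 < \<alpha>\<^sub>1" "\<alpha>\<^sub>1 < 1" "(\<alpha> \<longlongrightarrow> \<alpha>\<^sub>1) at_top"
    using adm unfolding admissible_order_def by auto
  then obtain c where c: "\<alpha>\<^sub>1 < c" "c < 1" using dense by blast
  then obtain T0 where T0: "\<And>t. T0 \<le> t \<Longrightarrow> \<alpha> t < c"
    using order_tendstoD(2)[OF \<alpha>1(3)] unfolding eventually_at_top_linorder by blast
  define T where "T = max T0 0"
  \<comment> \<open>The gap between \<open>c\<close> and \<open>d\<close> absorbs the term
    \<open>s * T\<close> for small \<open>s\<close>.\<close>
  obtain d where d: "c < d" "d < 1" using c dense by blast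
  have ev_exponent: "eventually (\<lambda>s. s * T + c < d) (at_right 0)"
  proof (rule order_tendstoD)
    show "((\<lambda>s. s * T + c) \<longlongrightarrow> 0 * T + c) (at_right 0)" by (intro tendsto_intros)
  qed (use d in simp)
  have "filterlim (\<lambda>s. s powr (d - 1) / (lam + 1)) at_top (at_right 0)"
    using d lam by real_asymp
  then have ev_B: "eventually (\<lambda>s. B \<le> s powr (d - 1) / (lam + 1)) (at_right 0)"
    by (simp add: filterlim_at_top)
  have ev_s: "eventually (\<lambda>s. s \<in> {0<..<1}) (at_right (0::real))"
    by (rule eventually_at_right_real) simp
  have "eventually (\<lambda>s. 0 < s \<and> s < 1 \<and> s * T + c < d \<and> B \<le> s powr (d - 1) / (lam + 1)) (at_right 0)"
    using ev_exponent ev_B ev_s by eventually_elim auto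
  then obtain s where s: "0 < s" "s < 1" "s * T + c < d" and B: "B \<le> s powr (d - 1) / (lam + 1)"
    using eventually_happens'[OF trivial_limit_at_right_real] by blast
  define p where "p = s * laplace \<alpha> s"
  have "s * laplace \<alpha> s \<le> s * T + c"
    by (rule laplace_le_of_eventually_le)
      (use s c \<alpha>1 \<alpha> T0 in \<open>auto simp: T_def less_imp_le\<close>)
  then have "p \<le> d" using s by (simp add: p_def)
  have "0 \<le> p" unfolding p_def using s \<alpha> by (intro mult_nonneg_nonneg laplace_nonneg) (auto intro: less_imp_le)
  \<comment> \<open>The base lies below 1, so powers decrease in the exponent.\<close>
  have "s powr (d - 1) \<le> s powr (p - 1)" using s \<open>p \<le> d\<close> by (intro powr_mono') auto
  moreover have "s powr p \<le> 1" using s \<open>0 \<le> p\<close> by (intro powr_le1) auto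
  ultimately have "s powr (d - 1) / (lam + 1) \<le> s powr (p - 1) / (lam + s powr p)"
    using lam by (intro frac_le) (auto intro: add_pos_nonneg)
  then show ?thesis using s B unfolding p_def by (meson order_trans)
qed

section \<open>Factorial moments and infinite interarrival moments of the renewal process\<close>

theorem theorem4p1:
  fixes lam :: real and \<alpha> u :: "real \<Rightarrow> real" and \<alpha>\<^sub>0 \<alpha>\<^sub>1 :: real
    and M :: "'a measure" and Z :: "nat \<Rightarrow> 'a \<Rightarrow> real"
  assumes "0 < lam"
    and "admissible_order \<alpha> \<alpha>\<^sub>0 \<alpha>\<^sub>1"
    and "relaxation_function lam \<alpha> u"
    and "iid_interarrival_times M Z u"
  shows "(\<forall>r\<ge>1. \<forall>s>0.
            nn_laplace (\<lambda>t. \<integral>\<^sup>+\<omega>. falling_factorial (counting_process Z t \<omega>) r \<partial>M) s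
              = ennreal (fact r * lam ^ r / s powr (real r * s * laplace \<alpha> s + 1))) \<and>
         (\<forall>r\<ge>(1::nat). \<forall>j\<ge>1. (\<integral>\<^sup>+\<omega>. ennreal (Z j \<omega> ^ r) \<partial>M) = \<infinity>)"
proof -
  interpret prob_space M using assms(4) by (simp add: iid_interarrival_times_def)
  have indep: "indep_vars (\<lambda>_. borel) Z {1..}"
    and pos: "\<And>j. 1 \<le> j \<Longrightarrow> AE \<omega> in M. 0 < Z j \<omega>"
    and surv: "\<And>j t. 1 \<le> j \<Longrightarrow> 0 \<le> t \<Longrightarrow> prob {\<omega> \<in> space M. t < Z j \<omega>} = u t"
    using assms(4) by (auto simp: iid_interarrival_times_def)
  have Z: "1 \<le> j \<Longrightarrow> Z j \<in> borel_measurable M" for j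
    using indep unfolding indep_vars_def by auto
  have nonneg: "1 \<le> j \<Longrightarrow> AE \<omega> in M. 0 \<le> Z j \<omega>" for j
    using pos[of j] by (auto elim: eventually_mono)
  define v where "v s = s powr (s * laplace \<alpha> s - 1) / (lam + s powr (s * laplace \<alpha> s))" for s
  have v_nonneg: "0 \<le> v s" for s using \<open>0 < lam\<close> by (simp add: v_def)
  have surv_laplace: "nn_laplace (\<lambda>t. emeasure M {\<omega> \<in> space M. t < Z j \<omega>}) s = ennreal (v s)"
    if "1 \<le> j" "0 < s" for j s
    using nn_laplace_survival[OF Z[OF that(1)] that(2) surv[OF that(1)]] assms(3) that(2)
    by (simp add: relaxation_function_def v_def)
  have moments: "(\<integral>\<^sup>+\<omega>. ennreal (Z j \<omega> ^ r) \<partial>M) = \<infinity>" if "1 \<le> r" "1 \<le> j" for r j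
  proof -
    \<comment> \<open>The point \<open>s\<close> is chosen depending on \<open>n\<close>: the
      transform of the survival function there is at least \<open>n\<close> and bounds the
      expectation from below.\<close>
    have "of_nat n \<le> (\<integral>\<^sup>+\<omega>. ennreal (Z j \<omega>) \<partial>M)" for n
    proof -
      obtain s where s: "0 < s" "real n \<le> v s"
        using relaxation_laplace_unbounded[OF assms(1,2), of "real n"] unfolding v_def by blast
      then have "of_nat n \<le> ennreal (v s)"
        by (simp add: ennreal_of_nat_eq_real_of_nat ennreal_leI)
      also have "\<dots> \<le> (\<integral>\<^sup>+\<omega>. ennreal (Z j \<omega>) \<partial>M)"
        using nn_laplace_survival_le_expectation[OF Z[OF that(2)] s(1)] surv_laplace[OF that(2) s(1)]
        by simp
      finally show ?thesis .
    qed
    then have "(\<integral>\<^sup>+\<omega>. ennreal (Z j \<omega>) \<partial>M) = \<infinity>"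
      using ennreal_Ex_less_of_nat[of "\<integral>\<^sup>+\<omega>. ennreal (Z j \<omega>) \<partial>M"] 
      by (metis infinity_ennreal_def less_top not_less)
    then show ?thesis using nn_moment_eq_top Z nonneg that by blast
  qed
  have "nn_laplace (\<lambda>t. \<integral>\<^sup>+\<omega>. falling_factorial (counting_process Z t \<omega>) r \<partial>M) s
      = ennreal (fact r * lam ^ r / s powr (real r * s * laplace \<alpha> s + 1))"
    if "1 \<le> r" and s: "0 < s" for r s
  proof -
    obtain m where r: "r = Suc m" using \<open>1 \<le> r\<close> by (cases r) auto
    define q where "q = s powr (s * laplace \<alpha> s)"
    have q: "0 < q" using s by (simp add: q_def)
    have "s * v s = q / (lam + q)"
      using s by (simp add: v_def q_def powr_diff)
    \<comment> \<open>This value is the Laplace transform of the law of \<open>Z j\<close> at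
      \<open>s\<close>.\<close>
    then have \<phi>: "1 - s * v s = lam / (lam + q)"
      using q \<open>0 < lam\<close> by (simp add: field_simps)
    have ratio: "(lam / (lam + q)) / (1 - lam / (lam + q)) = lam / q"
    proof -
      have "1 - lam / (lam + q) = q / (lam + q)" using q \<open>0 < lam\<close> by (simp add: field_simps)
      then show ?thesis using q \<open>0 < lam\<close> by simp
    qed
    have "nn_laplace (\<lambda>t. \<integral>\<^sup>+\<omega>. falling_factorial (counting_process Z t \<omega>) (Suc m) \<partial>M) s
        = ennreal (fact (Suc m) * (lam / (lam + q) / (1 - lam / (lam + q))) ^ Suc m / s)"
    proof (rule nn_laplace_factorial_moment[OF indep pos _ s])
      fix j :: nat assume "1 \<le> j"
      then show "(\<integral>\<^sup>+\<omega>. ennreal (exp (- s * Z j \<omega>)) \<partial>M) = ennreal (lam / (lam + q))"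
        using nn_integral_exp_of_survival[OF Z nonneg s surv_laplace v_nonneg] s \<phi> by simp
    qed (use q \<open>0 < lam\<close> in auto)
    \<comment> \<open>The additional factor \<open>s\<close> matches the division by
      \<open>s\<close> in the transform of a distribution function.\<close>
    moreover have "s powr (real r * s * laplace \<alpha> s + 1) = q ^ r * s"
      using s by (simp add: q_def powr_add powr_powr powr_realpow[symmetric] mult_ac)
    ultimately show ?thesis
      unfolding ratio by (simp add: r power_divide del: fact_Suc power_Suc)
  qed
  then show ?thesis using moments by blast
qed

end
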